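(* Let $a>1$ and $b\in\mathbb{C}$ be such that $C_{az+b}$ is a bounded composition operator on $\mathcal{H}(\beta,\Lambda)$, and suppose that $(\lambda_n)_{n\ge1}$ has precisely one initial point with respect to $a$. Then $C_{az+b}$ is cyclic but not supercyclic.
   Context: $\mathbb{N}=\{1,2,\dots\}$. $\Lambda=(\lambda_n)_{n\ge1}$ is a strictly increasing sequence of non-negative real numbers tending to $\infty$ with $L:=\limsup_{n\to\infty}\frac{\log n}{\lambda_n}<\infty$. $\beta=(\beta_n)_{n\ge1}$ is a sequence of positive real numbers with $\beta_*:=\liminf_{n\to\infty}\frac{\log\beta_n}{\lambda_n}\neq\pm\infty$. For $r\in\mathbb{R}$, $\mathbb{C}_r=\{z\in\mathbb{C}:\operatorname{Re}(z)>r\}$. $\mathcal{H}(\beta,\Lambda)$ is the space of Dirichlet series $f(z)=\sum_{n=1}^\infty a_ne^{-\lambda_nz}$ with $\sum_{n=1}^\infty|a_n|^2\beta_n^2<\infty$; such series converge to holomorphic functions on $\mathbb{C}_{L/2-\beta_*}$, their coefficients are uniquely determined by $f$, and $\mathcal{H}(\beta,\Lambda)$ is a Hilbert space with inner product $\langle f,g\rangle=\sum_{n}a_n\overline{b_n}\beta_n^2$. $C_\varphi f=f\circ\varphi$ ($C_{az+b}$ is $C_\varphi$ for $\varphi(z)=az+b$); "$C_\varphi$ is a bounded composition operator on $\mathcal{H}(\beta,\Lambda)$" means that $\varphi$ is a holomorphic self-map of $\mathbb{C}_{L/2-\beta_*}$ and $C_\varphi$ maps $\mathcal{H}(\beta,\Lambda)$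 into itself boundedly. If $C_{az+b}$ is bounded with $a>1$, then for every $n$ there is $m\ge n$ with $a\lambda_n=\lambda_m$. A term $\lambda_k$ is an initial point with respect to $a$ if there is no $n<k$ such that $a^s\lambda_n=\lambda_k$ for some $s\in\mathbb{N}$ (so $\lambda_1$ is always an initial point, including when $\lambda_1=0$). For a bounded operator $T$ on a Hilbert space $\mathcal{H}$ and $x\in\mathcal{H}$, $\operatorname{Orb}(T,x)=\{T^nx:n=0,1,2,\dots\}$. $T$ is cyclic if there is $x$ with $\operatorname{Span}(\operatorname{Orb}(T,x))$ dense in $\mathcal{H}$, and supercyclic if there is $x$ with $\{\mu y:y\in\operatorname{Orb}(T,x),\ \mu\in\mathbb{C}\}$ dense in $\mathcal{H}$. *)

theory Defs
  imports "HOL-Analysis.Analysis" "HOL-Library.Function_Algebras"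
begin

(* Sequences (Lambda_n), (beta_n), (a_n) are indexed by n >= 1; their values at the index 0
   carry no meaning, and series over n >= 1 are written as series over Suc n. *)

definition half_plane :: "real \<Rightarrow> complex set" where
  "half_plane r = {z. Re z > r}"

definition Llimsup :: "(nat \<Rightarrow> real) \<Rightarrow> ereal" where
  "Llimsup \<Lambda> = limsup (\<lambda>n. ereal (ln (real n) / \<Lambda> n))"

definition beta_star :: "(nat \<Rightarrow> real) \<Rightarrow> (nat \<Rightarrow> real) \<Rightarrow> ereal" where
  "beta_star \<beta> \<Lambda> = liminf (\<lambda>n. ereal (ln (\<beta> n) / \<Lambda> n))"

definition H_domain :: "(nat \<Rightarrow> real) \<Rightarrow> (nat \<Rightarrow> real) \<Rightarrow> complex set" where
  "H_domain \<beta> \<Lambda> = half_plane (real_of_ereal (Llimsup \<Lambda>) / 2 - real_of_ereal (beta_star \<beta> \<Lambda>))"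

(* A function on the half-plane is encoded as a total function that vanishes outside of it, so
   that equality of such functions is equality on the half-plane.  The convention a 0 = 0 makes
   the coefficient sequence unique (see the lemma has_coeffs_unique below). *)
definition has_coeffs ::
  "(nat \<Rightarrow> real) \<Rightarrow> (nat \<Rightarrow> real) \<Rightarrow> (complex \<Rightarrow> complex) \<Rightarrow> (nat \<Rightarrow> complex) \<Rightarrow> bool" where
  "has_coeffs \<beta> \<Lambda> f a \<longleftrightarrow>
     a 0 = 0 \<and>
     summable (\<lambda>n. (cmod (a (Suc n)))\<^sup>2 * (\<beta> (Suc n))\<^sup>2) \<and>
     (\<forall>z\<in>H_domain \<beta> \<Lambda>.
        (\<lambda>n. a (Suc n) * exp (- (complex_of_real (\<Lambda> (Suc n)) * z))) sums f z) \<and>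
     (\<forall>z. z \<notin> H_domain \<beta> \<Lambda> \<longrightarrow> f z = 0)"

definition H_space :: "(nat \<Rightarrow> real) \<Rightarrow> (nat \<Rightarrow> real) \<Rightarrow> (complex \<Rightarrow> complex) set" where
  "H_space \<beta> \<Lambda> = {f. \<exists>a. has_coeffs \<beta> \<Lambda> f a}"

(* The value outside of H_space is a dummy; it only serves to make the distance below
   symmetric and non-negative on the whole type, as Metric_space requires. *)
definition H_coeff :: "(nat \<Rightarrow> real) \<Rightarrow> (nat \<Rightarrow> real) \<Rightarrow> (complex \<Rightarrow> complex) \<Rightarrow> nat \<Rightarrow> complex" where
  "H_coeff \<beta> \<Lambda> f = (if f \<in> H_space \<beta> \<Lambda> then (THE a. has_coeffs \<beta> \<Lambda> f a) else (\<lambda>_. 0))"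

lemma summable_exp_weights:
  assumes L: "Llimsup \<Lambda> < \<infinity>" and inf: "filterlim \<Lambda> at_top sequentially"
  obtains \<delta> where "\<delta> > 0" "summable (\<lambda>n. exp (- (\<Lambda> n * \<delta>)))"
proof -
  obtain M where M: "Llimsup \<Lambda> < ereal M" using ereal_dense2[OF L] by blast
  define K where "K = max M 1"
  have "Llimsup \<Lambda> < ereal K"
    by (rule less_le_trans[OF M]) (simp add: K_def)
  then have ev: "\<forall>\<^sub>F n in sequentially. ereal (ln (real n) / \<Lambda> n) < ereal K"
    unfolding Llimsup_def by (rule Limsup_lessD)
  have ev2: "\<forall>\<^sub>F n in sequentially. 1 \<le> \<Lambda> n"
    using inf by (simp add: filterlim_at_top)
  have "\<forall>\<^sub>F n in sequentially. norm (exp (- (\<Lambda> n * (2 * K)))) \<le> 1 / real n ^ 2"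
    using ev ev2 eventually_gt_at_top[of 0]
  proof eventually_elim
    case (elim n)
    then have "ln (real n) < K * \<Lambda> n" by (simp add: divide_simps split: if_splits)
    then have "- (\<Lambda> n * (2 * K)) \<le> - (2 * ln (real n))" by (simp add: mult.commute)
    then have "exp (- (\<Lambda> n * (2 * K))) \<le> exp (- (2 * ln (real n)))" by simp
    also have "\<dots> = 1 / real n ^ 2"
    proof -
      have "exp (2 * ln (real n)) = exp (ln (real n)) ^ 2" by (simp add: exp_double)
      then show ?thesis using elim by (simp add: exp_minus inverse_eq_divide)
    qed
    finally show ?case by simp
  qed
  moreover have "summable (\<lambda>n. 1 / real n ^ 2)"
    using inverse_power_summable[of 2, where 'a=real] by (simp add: inverse_eq_divide)
  ultimately have "summable (\<lambda>n. exp (- (\<Lambda> n * (2 * K))))"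
    by (rule summable_comparison_test_ev)
  moreover have "2 * K > 0" by (simp add: K_def)
  ultimately show thesis using that by blast
qed

lemma dirichlet_zero:
  fixes c :: "nat \<Rightarrow> complex"
  assumes mono: "strict_mono \<Lambda>" and sm: "summable (\<lambda>n. exp (- (\<Lambda> n * \<delta>)))"
    and z: "\<And>s. s > r \<Longrightarrow> (\<lambda>n. c n * exp (- (of_real (\<Lambda> n) * of_real s))) sums 0"
  shows "c N = 0"
proof (induction N rule: less_induct)
  case (less N)
  define s0 where "s0 = r + 1"
  have "(\<lambda>n. c n * exp (- (of_real (\<Lambda> n) * of_real s0))) \<longlonglongrightarrow> 0"
    by (rule summable_LIMSEQ_zero, rule sums_summable, rule z) (simp add: s0_def)
  then have "Bseq (\<lambda>n. c n * exp (- (of_real (\<Lambda> n) * of_real s0)))"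
    by (intro convergent_imp_Bseq convergentI)
  then obtain B where B: "\<And>n. norm (c n * exp (- (of_real (\<Lambda> n) * of_real s0))) \<le> B" "B > 0"
    by (auto simp: Bseq_def)
  define s1 where "s1 = s0 + \<delta>"
  define t where "t n = norm (c n) * exp (- (\<Lambda> n * s1))" for n
  have t_le: "norm (t n) \<le> B * exp (- (\<Lambda> n * \<delta>))" for n
  proof -
    have "t n = norm (c n * exp (- (of_real (\<Lambda> n) * of_real s0))) * exp (- (\<Lambda> n * \<delta>))"
      by (simp add: t_def s1_def norm_mult exp_add[symmetric] algebra_simps)
    also have "\<dots> \<le> B * exp (- (\<Lambda> n * \<delta>))" using B(1)[of n] by (intro mult_right_mono) auto
    finally show ?thesis by (simp add: t_def)
  qed
  have tsum: "summable t"
    by (rule summable_comparison_test[OF _ summable_mult[OF sm, of B]]) (use t_le in auto)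
  define d where "d = \<Lambda> (Suc N) - \<Lambda> N"
  have d: "d > 0" using mono by (simp add: d_def strict_mono_def)
  define S where "S = exp (\<Lambda> N * s1) * (\<Sum>n. t (n + Suc N))"
  have bound: "norm (c N) \<le> exp (- (d * (s - s1))) * S" if s: "s > r" "s \<ge> s1" for s
  proof -
    let ?u = "\<lambda>n. c n * exp (- (of_real (\<Lambda> n) * of_real s)) :: complex"
    let ?g = "\<lambda>n. exp (- (\<Lambda> (Suc N) * (s - s1))) * t (n + Suc N)"
    have "?u sums 0" by (rule z[OF s(1)])
    then have "(\<lambda>n. ?u (n + Suc N)) sums (0 - (\<Sum>i<Suc N. ?u i))"
      by (rule sums_split_initial_segment)
    moreover have "(\<Sum>i<Suc N. ?u i) = ?u N" using less by simp
    ultimately have us: "(\<lambda>n. ?u (n + Suc N)) sums (- ?u N)" by simp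
    have le: "norm (?u (n + Suc N)) \<le> ?g n" for n
    proof -
      have "\<Lambda> (Suc N) \<le> \<Lambda> (n + Suc N)" using mono by (simp add: strict_mono_less_eq)
      then have "\<Lambda> (Suc N) * (s - s1) \<le> \<Lambda> (n + Suc N) * (s - s1)"
        using s by (intro mult_right_mono) auto
      then have "exp (- (\<Lambda> (n + Suc N) * s))
          \<le> exp (- (\<Lambda> (Suc N) * (s - s1))) * exp (- (\<Lambda> (n + Suc N) * s1))"
        by (simp add: exp_add[symmetric] algebra_simps)
      then have "norm (c (n + Suc N)) * exp (- (\<Lambda> (n + Suc N) * s)) \<le> norm (c (n + Suc N)) *
          (exp (- (\<Lambda> (Suc N) * (s - s1))) * exp (- (\<Lambda> (n + Suc N) * s1)))"
        by (rule mult_left_mono) simp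
      then show ?thesis by (simp add: t_def norm_mult mult_ac)
    qed
    have gs: "summable ?g" using tsum by (intro summable_mult) (subst summable_iff_shift)
    have "norm (?u N) = norm (\<Sum>n. ?u (n + Suc N))" using us by (simp add: sums_unique[symmetric])
    also have "\<dots> \<le> (\<Sum>n. ?g n)"
      by (rule norm_suminf_le[OF le gs])
    also have "\<dots> = exp (- (\<Lambda> (Suc N) * (s - s1))) * (\<Sum>n. t (n + Suc N))"
      using tsum by (subst suminf_mult) (auto simp del: add_Suc_right simp: summable_iff_shift)
    finally have "norm (c N) * exp (- (\<Lambda> N * s))
        \<le> exp (- (\<Lambda> (Suc N) * (s - s1))) * (\<Sum>n. t (n + Suc N))"
      by (simp add: norm_mult)
    then have "norm (c N) * exp (- (\<Lambda> N * s)) * exp (\<Lambda> N * s)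
        \<le> exp (- (\<Lambda> (Suc N) * (s - s1))) * (\<Sum>n. t (n + Suc N)) * exp (\<Lambda> N * s)"
      by (rule mult_right_mono) simp
    moreover have "norm (c N) * exp (- (\<Lambda> N * s)) * exp (\<Lambda> N * s) = norm (c N)"
      by (simp add: exp_minus)
    moreover have "exp (- (\<Lambda> (Suc N) * (s - s1))) * X * exp (\<Lambda> N * s)
        = exp (- (d * (s - s1))) * (exp (\<Lambda> N * s1) * X)" for X
      by (simp add: d_def exp_add[symmetric] algebra_simps exp_diff exp_minus field_simps)
    ultimately show ?thesis by (simp add: S_def)
  qed
  have "filterlim (\<lambda>s. d * (- s1 + s)) at_top at_top"
    using d by (intro filterlim_tendsto_pos_mult_at_top[OF tendsto_const]
      filterlim_tendsto_add_at_top[OF tendsto_const] filterlim_ident)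
  then have "filterlim (\<lambda>s. - (d * (s - s1))) at_bot at_top"
    by (simp add: filterlim_uminus_at_bot)
  then have "((\<lambda>s. exp (- (d * (s - s1)))) \<longlongrightarrow> 0) at_top"
    by (rule filterlim_compose[OF exp_at_bot])
  then have "((\<lambda>s. exp (- (d * (s - s1))) * S) \<longlongrightarrow> 0 * S) at_top"
    by (intro tendsto_mult tendsto_const)
  then have lim: "((\<lambda>s. exp (- (d * (s - s1))) * S) \<longlongrightarrow> 0) at_top" by simp
  have "norm (c N) \<le> 0"
  proof (rule tendsto_lowerbound[OF lim])
    show "\<forall>\<^sub>F s in at_top. norm (c N) \<le> exp (- (d * (s - s1))) * S"
      using eventually_gt_at_top[of r] eventually_ge_at_top[of s1]
      by eventually_elim (use bound in auto)
  qed simp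
  then show ?case by simp
qed

lemma has_coeffs_diff:
  assumes f: "has_coeffs \<beta> \<Lambda> f a" and g: "has_coeffs \<beta> \<Lambda> g c"
  shows "has_coeffs \<beta> \<Lambda> (f - g) (\<lambda>n. a n - c n)"
proof -
  have "summable (\<lambda>n. (cmod (a (Suc n) - c (Suc n)))\<^sup>2 * (\<beta> (Suc n))\<^sup>2)"
  proof (rule summable_comparison_test)
    show "summable (\<lambda>n. 2 * ((cmod (a (Suc n)))\<^sup>2 * (\<beta> (Suc n))\<^sup>2)
        + 2 * ((cmod (c (Suc n)))\<^sup>2 * (\<beta> (Suc n))\<^sup>2))"
      using f g by (intro summable_add summable_mult) (auto simp: has_coeffs_def)
    have "(cmod (x - y))\<^sup>2 \<le> 2 * (cmod x)\<^sup>2 + 2 * (cmod y)\<^sup>2" for x y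
    proof -
      have "(cmod (x - y))\<^sup>2 \<le> (cmod x + cmod y)\<^sup>2" by (simp add: norm_triangle_ineq4 power_mono)
      also have "\<dots> \<le> 2 * (cmod x)\<^sup>2 + 2 * (cmod y)\<^sup>2"
        using sum_squares_bound[of "cmod x" "cmod y"] by (simp add: power2_sum)
      finally show ?thesis .
    qed
    from mult_right_mono[OF this, of "w\<^sup>2" for w]
    show "\<exists>N. \<forall>n\<ge>N. norm ((cmod (a (Suc n) - c (Suc n)))\<^sup>2 * (\<beta> (Suc n))\<^sup>2)
       \<le> 2 * ((cmod (a (Suc n)))\<^sup>2 * (\<beta> (Suc n))\<^sup>2) + 2 * ((cmod (c (Suc n)))\<^sup>2 * (\<beta> (Suc n))\<^sup>2)"
      by (simp add: algebra_simps)
  qed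
  then show ?thesis
    using f g by (auto simp: has_coeffs_def left_diff_distrib intro: sums_diff)
qed

lemma has_coeffs_unique:
  assumes mono: "strict_mono_on {1..} \<Lambda>" and inf: "filterlim \<Lambda> at_top sequentially"
    and L: "Llimsup \<Lambda> < \<infinity>"
    and f: "has_coeffs \<beta> \<Lambda> f a" and g: "has_coeffs \<beta> \<Lambda> f c"
  shows "a = c"
proof
  fix n
  obtain \<delta> where \<delta>: "summable (\<lambda>n. exp (- (\<Lambda> n * \<delta>)))"
    by (rule summable_exp_weights[OF L inf])
  have z: "has_coeffs \<beta> \<Lambda> (f - f) (\<lambda>n. a n - c n)" by (rule has_coeffs_diff[OF f g])
  have "a (Suc m) - c (Suc m) = 0" for m
  proof (rule dirichlet_zero[where \<Lambda> = "\<lambda>n. \<Lambda> (Suc n)" and \<delta> = \<delta>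
        and r = "real_of_ereal (Llimsup \<Lambda>) / 2 - real_of_ereal (beta_star \<beta> \<Lambda>)"
        and c = "\<lambda>n. a (Suc n) - c (Suc n)"])
    show "strict_mono (\<lambda>n. \<Lambda> (Suc n))" using mono by (auto simp: strict_mono_on_def strict_mono_def)
    show "summable (\<lambda>n. exp (- (\<Lambda> (Suc n) * \<delta>)))"
      using summable_Suc_iff[of "\<lambda>n. exp (- (\<Lambda> n * \<delta>))"] \<delta> by blast
    fix s assume "s > real_of_ereal (Llimsup \<Lambda>) / 2 - real_of_ereal (beta_star \<beta> \<Lambda>)"
    then have "of_real s \<in> H_domain \<beta> \<Lambda>" by (simp add: H_domain_def half_plane_def)
    then show "(\<lambda>n. (a (Suc n) - c (Suc n)) * exp (- (of_real (\<Lambda> (Suc n)) * of_real s))) sums 0"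
      using z by (simp add: has_coeffs_def)
  qed
  then show "a n = c n" using f g by (cases n) (auto simp: has_coeffs_def)
qed

lemma H_coeff_eq:
  assumes "strict_mono_on {1..} \<Lambda>" "filterlim \<Lambda> at_top sequentially" "Llimsup \<Lambda> < \<infinity>"
    and f: "has_coeffs \<beta> \<Lambda> f a"
  shows "H_coeff \<beta> \<Lambda> f = a"
proof -
  have "(THE a. has_coeffs \<beta> \<Lambda> f a) = a"
    by (rule the_equality, rule f, rule has_coeffs_unique[OF assms(1-3) _ f])
  then show ?thesis using f by (auto simp: H_coeff_def H_space_def)
qed

definition H_inner ::
  "(nat \<Rightarrow> real) \<Rightarrow> (nat \<Rightarrow> real) \<Rightarrow> (complex \<Rightarrow> complex) \<Rightarrow> (complex \<Rightarrow> complex) \<Rightarrow> complex" where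
  "H_inner \<beta> \<Lambda> f g =
     (\<Sum>n. H_coeff \<beta> \<Lambda> f (Suc n) * cnj (H_coeff \<beta> \<Lambda> g (Suc n)) * of_real ((\<beta> (Suc n))\<^sup>2))"

definition H_norm :: "(nat \<Rightarrow> real) \<Rightarrow> (nat \<Rightarrow> real) \<Rightarrow> (complex \<Rightarrow> complex) \<Rightarrow> real" where
  "H_norm \<beta> \<Lambda> f = sqrt (Re (H_inner \<beta> \<Lambda> f f))"

definition H_dist ::
  "(nat \<Rightarrow> real) \<Rightarrow> (nat \<Rightarrow> real) \<Rightarrow> (complex \<Rightarrow> complex) \<Rightarrow> (complex \<Rightarrow> complex) \<Rightarrow> real" where
  "H_dist \<beta> \<Lambda> f g = H_norm \<beta> \<Lambda> (f - g)"

lemma H_norm_eq: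
  assumes "summable (\<lambda>n. (cmod (H_coeff \<beta> \<Lambda> f (Suc n)))\<^sup>2 * (\<beta> (Suc n))\<^sup>2)"
  shows "H_norm \<beta> \<Lambda> f = sqrt (\<Sum>n. (cmod (H_coeff \<beta> \<Lambda> f (Suc n)))\<^sup>2 * (\<beta> (Suc n))\<^sup>2)"
proof -
  have "H_inner \<beta> \<Lambda> f f
      = (\<Sum>n. of_real ((cmod (H_coeff \<beta> \<Lambda> f (Suc n)))\<^sup>2 * (\<beta> (Suc n))\<^sup>2))"
    by (simp only: H_inner_def of_real_mult complex_norm_square)
  also have "\<dots> = of_real (\<Sum>n. (cmod (H_coeff \<beta> \<Lambda> f (Suc n)))\<^sup>2 * (\<beta> (Suc n))\<^sup>2)"
    by (rule suminf_of_real[OF assms, symmetric])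
  finally show ?thesis by (simp add: H_norm_def)
qed

lemma l2_triangle:
  fixes u v :: "nat \<Rightarrow> complex"
  assumes u: "summable (\<lambda>n. (cmod (u n))\<^sup>2 * (w n)\<^sup>2)" and v: "summable (\<lambda>n. (cmod (v n))\<^sup>2 * (w n)\<^sup>2)"
  shows "sqrt (\<Sum>n. (cmod (u n + v n))\<^sup>2 * (w n)\<^sup>2)
    \<le> sqrt (\<Sum>n. (cmod (u n))\<^sup>2 * (w n)\<^sup>2) + sqrt (\<Sum>n. (cmod (v n))\<^sup>2 * (w n)\<^sup>2)" (is "?l \<le> ?r")
proof -
  have *: "(\<Sum>n<N. (cmod (u n + v n))\<^sup>2 * (w n)\<^sup>2) \<le> ?r\<^sup>2" for N
  proof -
    have part: "L2_set (\<lambda>n. cmod (x n) * \<bar>w n\<bar>) {..<N} \<le> sqrt (\<Sum>n. (cmod (x n))\<^sup>2 * (w n)\<^sup>2)"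
      if "summable (\<lambda>n. (cmod (x n))\<^sup>2 * (w n)\<^sup>2)" for x :: "nat \<Rightarrow> complex"
      using sum_le_suminf[OF that, of "{..<N}"] by (simp add: L2_set_def power_mult_distrib)
    have "L2_set (\<lambda>n. cmod (u n + v n) * \<bar>w n\<bar>) {..<N}
        \<le> L2_set (\<lambda>n. cmod (u n) * \<bar>w n\<bar> + cmod (v n) * \<bar>w n\<bar>) {..<N}"
      by (intro L2_set_mono) (auto simp flip: distrib_right intro!: mult_right_mono norm_triangle_ineq)
    also have "\<dots> \<le> L2_set (\<lambda>n. cmod (u n) * \<bar>w n\<bar>) {..<N} + L2_set (\<lambda>n. cmod (v n) * \<bar>w n\<bar>) {..<N}"
      by (rule L2_set_triangle_ineq)
    also have "\<dots> \<le> ?r" using part[OF u] part[OF v] by simp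
    finally show ?thesis by (auto simp: L2_set_def power_mult_distrib intro: sqrt_le_D)
  qed
  have "summable (\<lambda>n. (cmod (u n + v n))\<^sup>2 * (w n)\<^sup>2)"
    by (rule bounded_imp_summable[of _ "?r\<^sup>2"]) 
      (simp_all only: lessThan_Suc_atMost[symmetric] *, simp)
  then have "(\<Sum>n. (cmod (u n + v n))\<^sup>2 * (w n)\<^sup>2) \<le> ?r\<^sup>2" by (rule suminf_le_const) (rule *)
  moreover have "?r \<ge> 0" using u v by (intro add_nonneg_nonneg) (auto intro!: suminf_nonneg)
  ultimately show ?thesis by (rule real_le_lsqrt[rotated])
qed

lemma Metric_space_H:
  assumes "strict_mono_on {1..} \<Lambda>" "filterlim \<Lambda> at_top sequentially" "Llimsup \<Lambda> < \<infinity>"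
    and pos: "\<And>n. n \<ge> 1 \<Longrightarrow> \<beta> n > 0"
  shows "Metric_space (H_space \<beta> \<Lambda>) (H_dist \<beta> \<Lambda>)"
proof -
  note ceq = H_coeff_eq[OF assms(1-3)]
  have sm: "summable (\<lambda>n. (cmod (H_coeff \<beta> \<Lambda> f (Suc n)))\<^sup>2 * (\<beta> (Suc n))\<^sup>2)" for f
  proof (cases "f \<in> H_space \<beta> \<Lambda>")
    case True
    then obtain a where a: "has_coeffs \<beta> \<Lambda> f a" by (auto simp: H_space_def)
    then show ?thesis by (simp add: ceq[OF a]) (simp add: has_coeffs_def)
  qed (simp add: H_coeff_def)
  note nrm = H_norm_eq[OF sm]
  have zero: "has_coeffs \<beta> \<Lambda> (\<lambda>_. 0) (\<lambda>_. 0)" by (simp add: has_coeffs_def)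
  have diff: "H_coeff \<beta> \<Lambda> (f - g) = (\<lambda>n. H_coeff \<beta> \<Lambda> f n - H_coeff \<beta> \<Lambda> g n)"
    if fg: "f \<in> H_space \<beta> \<Lambda>" "g \<in> H_space \<beta> \<Lambda>" for f g
  proof -
    obtain a c where a: "has_coeffs \<beta> \<Lambda> f a" and c: "has_coeffs \<beta> \<Lambda> g c"
      using fg by (auto simp: H_space_def)
    show ?thesis using ceq[OF a] ceq[OF c] ceq[OF has_coeffs_diff[OF a c]] by simp
  qed
  show ?thesis
  proof
    fix f g
    show "0 \<le> H_dist \<beta> \<Lambda> f g" unfolding H_dist_def nrm
      by (intro real_sqrt_ge_zero suminf_nonneg sm) auto
    have neg: "has_coeffs \<beta> \<Lambda> (g - f) (\<lambda>n. - a n)" if a: "has_coeffs \<beta> \<Lambda> (f - g) a" for f g a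
    proof -
      have "(\<lambda>_. 0) - (f - g) = g - f" by (auto simp: fun_eq_iff)
      with has_coeffs_diff[OF zero a] show ?thesis by simp
    qed
    show "H_dist \<beta> \<Lambda> f g = H_dist \<beta> \<Lambda> g f"
    proof (cases "f - g \<in> H_space \<beta> \<Lambda>")
      case True
      then obtain a where a: "has_coeffs \<beta> \<Lambda> (f - g) a" by (auto simp: H_space_def)
      show ?thesis by (simp add: H_dist_def nrm ceq[OF a] ceq[OF neg[OF a]])
    next
      case False
      then have "g - f \<notin> H_space \<beta> \<Lambda>" using neg by (auto simp: H_space_def)
      with False show ?thesis by (simp add: H_dist_def nrm H_coeff_def)
    qed
  next
    fix f g assume fg: "f \<in> H_space \<beta> \<Lambda>" "g \<in> H_space \<beta> \<Lambda>"
    obtain a c where a: "has_coeffs \<beta> \<Lambda> f a" and c: "has_coeffs \<beta> \<Lambda> g c"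
      using fg by (auto simp: H_space_def)
    show "H_dist \<beta> \<Lambda> f g = 0 \<longleftrightarrow> f = g"
    proof
      assume "H_dist \<beta> \<Lambda> f g = 0"
      then have "(\<Sum>n. (cmod (H_coeff \<beta> \<Lambda> (f - g) (Suc n)))\<^sup>2 * (\<beta> (Suc n))\<^sup>2) = 0"
        by (simp add: H_dist_def nrm)
      then have "(cmod (H_coeff \<beta> \<Lambda> (f - g) (Suc n)))\<^sup>2 * (\<beta> (Suc n))\<^sup>2 = 0" for n
        using suminf_eq_zero_iff[OF sm] by auto
      then have "a (Suc n) = c (Suc n) \<or> \<beta> (Suc n) = 0" for n
        by (simp add: diff[OF fg] ceq[OF a] ceq[OF c])
      then have "a (Suc n) = c (Suc n)" for n
        using pos[of "Suc n"] by (metis less_irrefl le_add1 plus_1_eq_Suc)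
      then have "a n = c n" for n using a c by (cases n) (auto simp: has_coeffs_def)
      then have ac: "a = c" by (simp add: fun_eq_iff)
      show "f = g"
      proof
        fix z
        show "f z = g z"
        proof (cases "z \<in> H_domain \<beta> \<Lambda>")
          case True
          with a c ac show ?thesis unfolding has_coeffs_def by (blast intro: sums_unique2)
        next
          case False
          with a c show ?thesis by (simp add: has_coeffs_def)
        qed
      qed
    next
      assume "f = g"
      then show "H_dist \<beta> \<Lambda> f g = 0" using diff[OF fg] by (simp add: H_dist_def nrm)
    qed
    fix h assume h: "h \<in> H_space \<beta> \<Lambda>"
    have "H_coeff \<beta> \<Lambda> (f - h) = (\<lambda>n. H_coeff \<beta> \<Lambda> (f - g) n + H_coeff \<beta> \<Lambda> (g - h) n)"
      using fg h by (simp add: diff)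
    then show "H_dist \<beta> \<Lambda> f h \<le> H_dist \<beta> \<Lambda> f g + H_dist \<beta> \<Lambda> g h"
      unfolding H_dist_def nrm using l2_triangle[OF sm[of "f - g"] sm[of "g - h"]] by simp
  qed
qed

definition H_topology :: "(nat \<Rightarrow> real) \<Rightarrow> (nat \<Rightarrow> real) \<Rightarrow> (complex \<Rightarrow> complex) topology" where
  "H_topology \<beta> \<Lambda> = Metric_space.mtopology (H_space \<beta> \<Lambda>) (H_dist \<beta> \<Lambda>)"

definition comp_op ::
  "(nat \<Rightarrow> real) \<Rightarrow> (nat \<Rightarrow> real) \<Rightarrow> (complex \<Rightarrow> complex) \<Rightarrow> (complex \<Rightarrow> complex) \<Rightarrow> complex \<Rightarrow> complex"
  where
  "comp_op \<beta> \<Lambda> \<phi> f = (\<lambda>z. if z \<in> H_domain \<beta> \<Lambda> then f (\<phi> z) else 0)"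

definition bounded_comp_op ::
  "(nat \<Rightarrow> real) \<Rightarrow> (nat \<Rightarrow> real) \<Rightarrow> (complex \<Rightarrow> complex) \<Rightarrow> bool" where
  "bounded_comp_op \<beta> \<Lambda> \<phi> \<longleftrightarrow>
     \<phi> holomorphic_on H_domain \<beta> \<Lambda> \<and>
     \<phi> ` H_domain \<beta> \<Lambda> \<subseteq> H_domain \<beta> \<Lambda> \<and>
     comp_op \<beta> \<Lambda> \<phi> ` H_space \<beta> \<Lambda> \<subseteq> H_space \<beta> \<Lambda> \<and>
     (\<exists>K. \<forall>f\<in>H_space \<beta> \<Lambda>. H_norm \<beta> \<Lambda> (comp_op \<beta> \<Lambda> \<phi> f) \<le> K * H_norm \<beta> \<Lambda> f)"

definition initial_point :: "(nat \<Rightarrow> real) \<Rightarrow> real \<Rightarrow> nat \<Rightarrow> bool" where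
  "initial_point \<Lambda> a k \<longleftrightarrow>
     1 \<le> k \<and> \<not> (\<exists>n s. 1 \<le> n \<and> n < k \<and> 1 \<le> s \<and> a ^ s * \<Lambda> n = \<Lambda> k)"

definition fscale :: "complex \<Rightarrow> (complex \<Rightarrow> complex) \<Rightarrow> complex \<Rightarrow> complex" where
  "fscale c f = (\<lambda>z. c * f z)"

interpretation fun_space: vector_space fscale
  by unfold_locales (auto simp: fscale_def fun_eq_iff algebra_simps)

definition Orb :: "('v \<Rightarrow> 'v) \<Rightarrow> 'v \<Rightarrow> 'v set" where
  "Orb T x = {(T ^^ n) x | n. True}"

definition cyclic_operator ::
  "(complex \<Rightarrow> complex) topology \<Rightarrow> ((complex \<Rightarrow> complex) \<Rightarrow> complex \<Rightarrow> complex) \<Rightarrow> bool" where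
  "cyclic_operator X T \<longleftrightarrow>
     (\<exists>x\<in>topspace X. X closure_of (fun_space.span (Orb T x)) = topspace X)"

definition supercyclic_operator ::
  "(complex \<Rightarrow> complex) topology \<Rightarrow> ((complex \<Rightarrow> complex) \<Rightarrow> complex \<Rightarrow> complex) \<Rightarrow> bool" where
  "supercyclic_operator X T \<longleftrightarrow>
     (\<exists>x\<in>topspace X. X closure_of {fscale \<mu> y | \<mu> y. y \<in> Orb T x} = topspace X)"

end

theory Submission
  imports Defs
begin

text \<open>
  A frequency that is not the first one arises from an earlier one by multiplication with a power
  of \<open>a\<close> as soon as there is only one initial point.  Hence \<open>\<Lambda> 1 > 0\<close> (otherwise \<open>\<Lambda> 2\<close> would be
  a second initial point) and every frequency lies in the progression \<open>a ^ s * \<Lambda> 1\<close>.  Conversely,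
  composing a single exponential with \<open>a z + b\<close> multiplies its frequency by \<open>a\<close>, and the result has
  to be a Dirichlet series over \<open>\<Lambda>\<close>; by uniqueness of coefficients (lemma \<open>frequency_of_exponential\<close>)
  the set of frequencies is closed under multiplication by \<open>a\<close>.  Therefore \<open>\<Lambda>\<close> is exactly this
  geometric progression (lemma \<open>frequency_step\<close>), and the operator is a weighted forward shift with
  nonzero weights on the orthogonal basis of exponentials.

  Such a shift is cyclic: the orbit of the first basis vector consists of nonzero multiples of all
  basis vectors, whose span is dense because a function is the limit of the partial sums of its
  Dirichlet series (lemma \<open>partial_sums_dense\<close>).

  It is not supercyclic: every image under the shift has first coefficient zero.  Hence near a
  function with nonzero first coefficient, the projective orbit of \<open>x\<close> contains only multiples of
  \<open>x\<close> itself.  All of these have the same ratio between the second and the first coefficient, so by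
  continuity of the coefficients they cannot approach both the first basis vector, with ratio \<open>0\<close>,
  and the sum of the first two, with ratio \<open>1\<close>.
\<close>

section \<open>Frequencies of Dirichlet series\<close>

text \<open>
  If \<open>\<mu>\<close> were not a frequency, it could be inserted into the sequence at the position \<open>p\<close> given
  by its size.  Moving \<open>K * exp (- \<mu> s)\<close> to the other side would then give a Dirichlet series over
  the enlarged sequence with sum zero and with the nonzero coefficient \<open>- K\<close>.
\<close>

lemma frequency_of_exponential:
  fixes c :: "nat \<Rightarrow> complex"
  assumes mono: "strict_mono \<Lambda>" and lim: "filterlim \<Lambda> at_top sequentially"
    and sm: "summable (\<lambda>n. exp (- (\<Lambda> n * \<delta>)))"
    and series: "\<And>s. s > r \<Longrightarrow> (\<lambda>n. c n * exp (- (of_real (\<Lambda> n) * of_real s)))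
                       sums (K * exp (- (of_real \<mu> * of_real s)))"
    and "K \<noteq> 0"
  shows "\<mu> \<in> range \<Lambda>"
proof (rule ccontr)
  assume notin: "\<mu> \<notin> range \<Lambda>"
  have "\<exists>n. \<Lambda> n > \<mu>"
    using lim by (metis eventually_sequentially filterlim_at_top_dense order_refl)
  define p where "p = (LEAST n. \<Lambda> n > \<mu>)"
  have above: "\<Lambda> p > \<mu>" unfolding p_def using \<open>\<exists>n. \<Lambda> n > \<mu>\<close> by (rule LeastI_ex)
  have below: "\<Lambda> n < \<mu>" if "n < p" for n
    using not_less_Least[of n "\<lambda>n. \<Lambda> n > \<mu>"] that notin
    by (metis linorder_neqE_linordered_idom p_def rangeI)
  define M where "M n = (if n < p then \<Lambda> n else if n = p then \<mu> else \<Lambda> (n - 1))" for n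
  define d where "d n = (if n < p then c n else if n = p then - K else c (n - 1))" for n
  define g where "g n = (if n < p then n else Suc n)" for n
  have g: "strict_mono g" by (auto simp: strict_mono_def g_def)
  have Mg: "M (g n) = \<Lambda> n" and dg: "d (g n) = c n" for n
    by (auto simp: M_def d_def g_def)
  have range_g: "n = p" if "n \<notin> range g" for n
  proof (rule ccontr)
    assume "n \<noteq> p"
    then have "n = g (if n < p then n else n - 1)" by (auto simp: g_def)
    with that show False by blast
  qed
  have "d p = 0"
  proof (rule dirichlet_zero[where c = d and \<Lambda> = M and \<delta> = \<delta> and r = r])
    show "strict_mono M"
      unfolding strict_mono_Suc_iff
    proof
      fix n
      consider "Suc n < p" | "Suc n = p" | "n = p" | "n > p" by linarith
      then show "M n < M (Suc n)"
        by cases (use above below mono in \<open>auto simp: M_def strict_mono_def\<close>)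
    qed
    have "summable (\<lambda>n. exp (- (\<Lambda> (Suc n - 1) * \<delta>)))" using sm by simp
    then have "summable (\<lambda>n. exp (- (\<Lambda> (n - 1) * \<delta>)))"
      by (subst (asm) summable_Suc_iff)
    moreover have "\<forall>\<^sub>F n in sequentially. exp (- (M n * \<delta>)) = exp (- (\<Lambda> (n - 1) * \<delta>))"
      using eventually_gt_at_top[of p] by eventually_elim (auto simp: M_def)
    ultimately show "summable (\<lambda>n. exp (- (M n * \<delta>)))" by (simp only: summable_cong)
  next
    fix s assume "s > r"
    let ?t = "\<lambda>n. d n * exp (- (of_real (M n) * of_real s))"
    let ?u = "\<lambda>n. if n = p then 0 else ?t n"
    have gp: "g n \<noteq> p" for n by (auto simp: g_def)
    have "(\<lambda>n. ?u (g n)) sums (K * exp (- (of_real \<mu> * of_real s)))"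
      using series[OF \<open>s > r\<close>] by (simp add: gp Mg dg)
    then have "?u sums (K * exp (- (of_real \<mu> * of_real s)))"
      using sums_mono_reindex[OF g, of ?u] range_g by auto
    from sums_add[OF this sums_single[of p ?t]]
    have "(\<lambda>n. ?u n + (if n = p then ?t n else 0))
        sums (K * exp (- (of_real \<mu> * of_real s)) + ?t p)" .
    moreover have "K * exp (- (of_real \<mu> * of_real s)) + ?t p = 0" by (simp add: M_def d_def)
    moreover have "(\<lambda>n. ?u n + (if n = p then ?t n else 0)) = ?t" by auto
    ultimately show "?t sums 0" by simp
  qed
  with \<open>K \<noteq> 0\<close> show False by (simp add: d_def)
qed

section \<open>Coefficients and distances\<close>

definition monomial :: "(nat \<Rightarrow> real) \<Rightarrow> (nat \<Rightarrow> real) \<Rightarrow> nat \<Rightarrow> complex \<Rightarrow> complex" where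
  "monomial \<beta> \<Lambda> n = (\<lambda>z. if z \<in> H_domain \<beta> \<Lambda> then exp (- (of_real (\<Lambda> n) * z)) else 0)"

lemma sum_monomials_apply:
  "(\<Sum>k\<in>A. fscale (c k) (monomial \<beta> \<Lambda> k)) z
     = (\<Sum>k\<in>A. c k * monomial \<beta> \<Lambda> k z)"
  by (induction A rule: infinite_finite_induct) (auto simp: fscale_def)

lemma has_coeffs_sum_monomials:
  assumes "finite A" "0 \<notin> A"
  shows "has_coeffs \<beta> \<Lambda> (\<Sum>k\<in>A. fscale (c k) (monomial \<beta> \<Lambda> k)) (\<lambda>k. if k \<in> A then c k else 0)"
  unfolding has_coeffs_def
proof (intro conjI ballI allI impI)
  have fin: "finite (Suc -` A)" by (rule finite_vimageI) (use assms in auto)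
  show "summable (\<lambda>n. (cmod (if Suc n \<in> A then c (Suc n) else 0))\<^sup>2 * (\<beta> (Suc n))\<^sup>2)"
    by (rule summable_finite[OF fin]) auto
  show "(if 0 \<in> A then c 0 else 0) = 0" using assms by simp
  fix z
  show "(\<Sum>k\<in>A. fscale (c k) (monomial \<beta> \<Lambda> k)) z = 0" if "z \<notin> H_domain \<beta> \<Lambda>"
    using that by (simp only: sum_monomials_apply) (simp add: monomial_def)
  assume z: "z \<in> H_domain \<beta> \<Lambda>"
  let ?t = "\<lambda>k. (if k \<in> A then c k else 0) * exp (- (of_real (\<Lambda> k) * z))"
  have "(\<lambda>n. ?t (Suc n)) sums (\<Sum>n\<in>Suc -` A. ?t (Suc n))"
    by (rule sums_finite[OF fin]) auto
  also have "(\<Sum>n\<in>Suc -` A. ?t (Suc n)) = (\<Sum>k\<in>A. ?t k)"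
  proof -
    have "A \<subseteq> range Suc" using assms(2) by (metis not0_implies_Suc rangeI subsetI)
    then have "A = Suc ` (Suc -` A)" by auto
    then show ?thesis by (metis (no_types, lifting) comp_apply inj_on_subset inj_Suc subset_UNIV sum.cong sum.reindex)
  qed
  also have "\<dots> = (\<Sum>k\<in>A. fscale (c k) (monomial \<beta> \<Lambda> k)) z"
    using z by (simp only: sum_monomials_apply) (simp add: monomial_def)
  finally show "(\<lambda>n. ?t (Suc n)) sums (\<Sum>k\<in>A. fscale (c k) (monomial \<beta> \<Lambda> k)) z" .
qed

lemma has_coeffs_fscale:
  assumes "has_coeffs \<beta> \<Lambda> f c"
  shows "has_coeffs \<beta> \<Lambda> (fscale \<mu> f) (\<lambda>n. \<mu> * c n)"
proof -
  have "summable (\<lambda>n. (cmod \<mu>)\<^sup>2 * ((cmod (c (Suc n)))\<^sup>2 * (\<beta> (Suc n))\<^sup>2))"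
    using assms by (intro summable_mult) (simp add: has_coeffs_def)
  with assms show ?thesis
    by (auto simp: has_coeffs_def fscale_def norm_mult power_mult_distrib mult.assoc intro: sums_mult)
qed

lemma monomial_has_coeffs:
  assumes "n \<ge> 1"
  shows "has_coeffs \<beta> \<Lambda> (monomial \<beta> \<Lambda> n) (\<lambda>k. if k = n then 1 else 0)"
  using has_coeffs_sum_monomials[of "{n}" \<beta> \<Lambda> "\<lambda>_. 1"] assms by (simp add: fscale_def)

locale dirichlet_space =
  fixes \<Lambda> \<beta> :: "nat \<Rightarrow> real"
  assumes mono: "strict_mono_on {1..} \<Lambda>"
    and lim: "filterlim \<Lambda> at_top sequentially"
    and L: "Llimsup \<Lambda> < \<infinity>"
    and pos: "\<And>n. n \<ge> 1 \<Longrightarrow> \<beta> n > 0"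
begin

sublocale Metric_space "H_space \<beta> \<Lambda>" "H_dist \<beta> \<Lambda>"
  by (rule Metric_space_H[OF mono lim L pos])

lemma topspace_H: "topspace (H_topology \<beta> \<Lambda>) = H_space \<beta> \<Lambda>"
  by (simp add: H_topology_def)

lemma closure_H_eq_topspace:
  "H_topology \<beta> \<Lambda> closure_of S = topspace (H_topology \<beta> \<Lambda>) \<longleftrightarrow>
     (\<forall>f\<in>H_space \<beta> \<Lambda>. \<forall>\<epsilon>>0. \<exists>g\<in>S. g \<in> H_space \<beta> \<Lambda> \<and> H_dist \<beta> \<Lambda> f g < \<epsilon>)"
  unfolding H_topology_def metric_closure_of by (auto simp: in_mball)

lemma strict_mono_Suc_frequencies: "strict_mono (\<lambda>n. \<Lambda> (Suc n))"
  using mono by (auto simp: strict_mono_on_def strict_mono_def)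

lemma summable_frequencies:
  obtains \<delta> where "summable (\<lambda>n. exp (- (\<Lambda> (Suc n) * \<delta>)))"
proof -
  obtain \<delta> where "summable (\<lambda>n. exp (- (\<Lambda> n * \<delta>)))"
    by (rule summable_exp_weights[OF L lim])
  then have "summable (\<lambda>n. exp (- (\<Lambda> (Suc n) * \<delta>)))"
    using summable_Suc_iff[of "\<lambda>n. exp (- (\<Lambda> n * \<delta>))"] by blast
  then show thesis by (rule that)
qed

lemma of_real_in_H_domain:
  "s > real_of_ereal (Llimsup \<Lambda>) / 2 - real_of_ereal (beta_star \<beta> \<Lambda>)
     \<Longrightarrow> of_real s \<in> H_domain \<beta> \<Lambda>"
  by (simp add: H_domain_def half_plane_def)

text \<open>
  For a function that is already known to lie in the space, the weighted square summability of a
  coefficient sequence comes for free: the sequence must agree with the one that witnesses membership.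
\<close>

lemma has_coeffs_if_sums:
  assumes "f \<in> H_space \<beta> \<Lambda>" "d 0 = 0"
    and sums: "\<And>z. z \<in> H_domain \<beta> \<Lambda> \<Longrightarrow> (\<lambda>n. d (Suc n) * exp (- (of_real (\<Lambda> (Suc n)) * z))) sums f z"
  shows "has_coeffs \<beta> \<Lambda> f d"
proof -
  obtain c where c: "has_coeffs \<beta> \<Lambda> f c" using assms(1) by (auto simp: H_space_def)
  obtain \<delta> where \<delta>: "summable (\<lambda>n. exp (- (\<Lambda> (Suc n) * \<delta>)))" by (rule summable_frequencies)
  have "c (Suc n) - d (Suc n) = 0" for n
  proof (rule dirichlet_zero[OF strict_mono_Suc_frequencies \<delta>, of _ "\<lambda>n. c (Suc n) - d (Suc n)"])
    fix s assume s: "s > real_of_ereal (Llimsup \<Lambda>) / 2 - real_of_ereal (beta_star \<beta> \<Lambda>)"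
    let ?s = "complex_of_real s"
    have "(\<lambda>n. c (Suc n) * exp (- (of_real (\<Lambda> (Suc n)) * ?s))) sums f ?s"
      using c of_real_in_H_domain[OF s] by (simp add: has_coeffs_def)
    from sums_diff[OF this sums[OF of_real_in_H_domain[OF s]]]
    show "(\<lambda>n. (c (Suc n) - d (Suc n)) * exp (- (of_real (\<Lambda> (Suc n)) * ?s))) sums 0"
      by (simp add: left_diff_distrib)
  qed
  moreover have "c 0 = d 0" using c \<open>d 0 = 0\<close> by (simp add: has_coeffs_def)
  ultimately have "c = d" by (auto simp: fun_eq_iff) (metis not0_implies_Suc)
  with c show ?thesis by simp
qed

lemma H_dist_eq:
  assumes "has_coeffs \<beta> \<Lambda> f c" "has_coeffs \<beta> \<Lambda> g d"
  shows "H_dist \<beta> \<Lambda> f g = sqrt (\<Sum>n. (cmod (c (Suc n) - d (Suc n)))\<^sup>2 * (\<beta> (Suc n))\<^sup>2)"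
proof -
  note diff = has_coeffs_diff[OF assms]
  have "H_coeff \<beta> \<Lambda> (f - g) = (\<lambda>n. c n - d n)" by (rule H_coeff_eq[OF mono lim L diff])
  then show ?thesis
    using diff H_norm_eq[of \<beta> \<Lambda> "f - g"] by (simp add: H_dist_def has_coeffs_def)
qed

lemma coeff_diff_le_dist:
  assumes "has_coeffs \<beta> \<Lambda> f c" "has_coeffs \<beta> \<Lambda> g d"
  shows "cmod (c (Suc k) - d (Suc k)) * \<beta> (Suc k) \<le> H_dist \<beta> \<Lambda> f g"
proof -
  let ?t = "\<lambda>n. (cmod (c (Suc n) - d (Suc n)))\<^sup>2 * (\<beta> (Suc n))\<^sup>2"
  have "summable ?t" using has_coeffs_diff[OF assms] by (simp add: has_coeffs_def)
  then have "?t k \<le> (\<Sum>n. ?t n)"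
    using sum_le_suminf[of ?t "{k}"] by simp
  then show ?thesis
    by (simp add: H_dist_eq[OF assms] real_le_rsqrt power_mult_distrib)
qed

lemma partial_sums_dense:
  assumes f: "has_coeffs \<beta> \<Lambda> f c" and "\<epsilon> > 0"
  shows "\<exists>N. H_dist \<beta> \<Lambda> f (\<Sum>k\<in>{1..N}. fscale (c k) (monomial \<beta> \<Lambda> k)) < \<epsilon>"
proof -
  let ?t = "\<lambda>n. (cmod (c (Suc n)))\<^sup>2 * (\<beta> (Suc n))\<^sup>2"
  have sm: "summable ?t" using f by (simp add: has_coeffs_def)
  have "(\<lambda>N. \<Sum>n. ?t (n + N)) \<longlonglongrightarrow> 0"
    using suminf_exist_split2[OF sm] by simp
  then have "\<forall>\<^sub>F N in sequentially. (\<Sum>n. ?t (n + N)) < \<epsilon>\<^sup>2"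
    by (rule order_tendstoD) (use \<open>\<epsilon> > 0\<close> in simp)
  then obtain N where N: "(\<Sum>n. ?t (n + N)) < \<epsilon>\<^sup>2" by (auto simp: eventually_sequentially)
  let ?d = "\<lambda>k. if k \<in> {1..N} then c k else 0"
  let ?u = "\<lambda>n. (cmod (c (Suc n) - ?d (Suc n)))\<^sup>2 * (\<beta> (Suc n))\<^sup>2"
  have d: "has_coeffs \<beta> \<Lambda> (\<Sum>k\<in>{1..N}. fscale (c k) (monomial \<beta> \<Lambda> k)) ?d"
    by (rule has_coeffs_sum_monomials) auto
  have "summable ?u" using has_coeffs_diff[OF f d] by (simp add: has_coeffs_def)
  from suminf_split_initial_segment[OF this, of N]
  have "(\<Sum>n. ?u n) = (\<Sum>n. ?t (n + N))" by simp
  with N have "sqrt (\<Sum>n. ?u n) < \<epsilon>" using \<open>\<epsilon> > 0\<close> by (simp add: real_less_lsqrt)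
  then show ?thesis by (simp only: H_dist_eq[OF f d, symmetric]) (rule exI)
qed

end

section \<open>Affine symbols as weighted shifts\<close>

locale affine_composition = dirichlet_space +
  fixes a :: real and b :: complex
  assumes a: "a > 1"
    and bounded: "bounded_comp_op \<beta> \<Lambda> (\<lambda>z. of_real a * z + b)"
begin

abbreviation T :: "(complex \<Rightarrow> complex) \<Rightarrow> complex \<Rightarrow> complex" where
  "T \<equiv> comp_op \<beta> \<Lambda> (\<lambda>z. of_real a * z + b)"

lemma T_in_H_space: "f \<in> H_space \<beta> \<Lambda> \<Longrightarrow> T f \<in> H_space \<beta> \<Lambda>"
  using bounded by (auto simp: bounded_comp_op_def)

lemma symbol_in_H_domain: "z \<in> H_domain \<beta> \<Lambda> \<Longrightarrow> of_real a * z + b \<in> H_domain \<beta> \<Lambda>"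
  using bounded by (auto simp: bounded_comp_op_def)

lemma T_monomial:
  assumes "z \<in> H_domain \<beta> \<Lambda>"
  shows "T (monomial \<beta> \<Lambda> n) z
    = exp (- (of_real (\<Lambda> n) * b)) * exp (- (of_real (a * \<Lambda> n) * z))"
  using assms symbol_in_H_domain[OF assms]
  by (simp add: comp_op_def monomial_def exp_add[symmetric] algebra_simps)

lemma frequencies_closed:
  assumes "n \<ge> 1"
  shows "\<exists>m\<ge>1. \<Lambda> m = a * \<Lambda> n"
proof -
  have "monomial \<beta> \<Lambda> n \<in> H_space \<beta> \<Lambda>"
    using monomial_has_coeffs[OF assms] by (auto simp: H_space_def)
  then obtain c where c: "has_coeffs \<beta> \<Lambda> (T (monomial \<beta> \<Lambda> n)) c"
    using T_in_H_space by (force simp: H_space_def)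
  obtain \<delta> where \<delta>: "summable (\<lambda>n. exp (- (\<Lambda> (Suc n) * \<delta>)))" by (rule summable_frequencies)
  have "a * \<Lambda> n \<in> range (\<lambda>n. \<Lambda> (Suc n))"
  proof (rule frequency_of_exponential[OF strict_mono_Suc_frequencies _ \<delta>,
        where c = "\<lambda>n. c (Suc n)" and K = "exp (- (of_real (\<Lambda> n) * b))"])
    show "filterlim (\<lambda>n. \<Lambda> (Suc n)) at_top sequentially"
      using lim by (subst filterlim_sequentially_Suc)
    fix s assume s: "s > real_of_ereal (Llimsup \<Lambda>) / 2 - real_of_ereal (beta_star \<beta> \<Lambda>)"
    show "(\<lambda>n. c (Suc n) * exp (- (of_real (\<Lambda> (Suc n)) * of_real s)))
        sums (exp (- (of_real (\<Lambda> n) * b)) * exp (- (of_real (a * \<Lambda> n) * of_real s)))"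
      using c of_real_in_H_domain[OF s]
      by (simp only: has_coeffs_def T_monomial[OF of_real_in_H_domain[OF s], symmetric])
  qed simp
  then obtain m where "a * \<Lambda> n = \<Lambda> (Suc m)" by blast
  then show ?thesis by (intro exI[of _ "Suc m"]) simp
qed

end

text \<open>
  Nothing lies before the index \<open>1\<close>, so it is the unique initial point; the descent from any other
  index to an earlier one can only end there.
\<close>

lemma frequencies_from_unique_initial_point:
  assumes "\<exists>!k. initial_point \<Lambda> a k" "k \<ge> 1"
  shows "\<exists>s. \<Lambda> k = a ^ s * \<Lambda> 1"
  using assms(2)
proof (induction k rule: less_induct)
  case (less k)
  show ?case
  proof (cases "k = 1")
    case True
    then show ?thesis by (auto intro: exI[of _ 0])
  next
    case False
    have "initial_point \<Lambda> a 1" by (auto simp: initial_point_def)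
    then have "\<not> initial_point \<Lambda> a k" using False assms(1) by auto
    then obtain n s where n: "1 \<le> n" "n < k" "a ^ s * \<Lambda> n = \<Lambda> k"
      using less.prems by (auto simp: initial_point_def)
    from less.IH[OF n(2,1)] obtain t where "\<Lambda> n = a ^ t * \<Lambda> 1" by blast
    with n(3) have "\<Lambda> k = a ^ (s + t) * \<Lambda> 1" by (simp add: power_add)
    then show ?thesis by blast
  qed
qed

locale one_initial_point = affine_composition +
  assumes nonneg: "\<And>n. n \<ge> 1 \<Longrightarrow> \<Lambda> n \<ge> 0"
    and initial: "\<exists>!k. initial_point \<Lambda> a k"
begin

lemma first_frequency_pos: "\<Lambda> 1 > 0"
proof (rule ccontr)
  assume "\<not> \<Lambda> 1 > 0"
  then have "\<Lambda> 1 = 0" using nonneg[of 1] by simp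
  then have "\<Lambda> 2 = 0" using frequencies_from_unique_initial_point[OF initial, of 2] by auto
  moreover have "\<Lambda> 1 < \<Lambda> 2" using mono by (simp add: strict_mono_on_def)
  ultimately show False using \<open>\<Lambda> 1 = 0\<close> by simp
qed

text \<open>
  The frequencies form a subset of the progression \<open>a ^ s * \<Lambda> 1\<close> that contains its first member
  and is closed under taking the next one.  It is therefore the whole progression, and both are
  enumerated in increasing order.
\<close>

lemma frequencies_geometric: "\<Lambda> (Suc n) = a ^ n * \<Lambda> 1"
proof (induction n)
  case (Suc n)
  have less_iff: "\<Lambda> j < \<Lambda> k \<longleftrightarrow> j < k" if "j \<ge> 1" "k \<ge> 1" for j k
    using strict_mono_on_less[OF mono] that by auto
  obtain m where m: "m \<ge> 1" "\<Lambda> m = a * \<Lambda> (Suc n)" using frequencies_closed[of "Suc n"] by auto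
  have "\<Lambda> (Suc n) > 0" using first_frequency_pos a Suc.IH by simp
  then have "\<Lambda> (Suc n) < \<Lambda> m" using m a by simp
  then have "\<not> m < Suc (Suc n)" using less_iff[of "Suc n" m] m by auto
  then have "\<not> \<Lambda> m < \<Lambda> (Suc (Suc n))" using less_iff[of m "Suc (Suc n)"] m by auto
  then have upper: "\<Lambda> (Suc (Suc n)) \<le> a ^ Suc n * \<Lambda> 1" using m Suc.IH by simp
  obtain s where s: "\<Lambda> (Suc (Suc n)) = a ^ s * \<Lambda> 1"
    using frequencies_from_unique_initial_point[OF initial, of "Suc (Suc n)"] by auto
  have "a ^ n * \<Lambda> 1 < a ^ s * \<Lambda> 1" using less_iff[of "Suc n" "Suc (Suc n)"] s Suc.IH by auto
  then have "a ^ n < a ^ s" using first_frequency_pos by simp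
  then have "Suc n \<le> s" using a by simp
  then have "a ^ Suc n * \<Lambda> 1 \<le> a ^ s * \<Lambda> 1"
    using a first_frequency_pos by (intro mult_right_mono power_increasing) auto
  with upper s show ?case by linarith
qed simp

lemma frequency_step: "n \<ge> 1 \<Longrightarrow> a * \<Lambda> n = \<Lambda> (Suc n)"
  using frequencies_geometric[of n] frequencies_geometric[of "n - 1"]
  by (cases n) auto

lemma T_shifts_monomial:
  assumes "n \<ge> 1"
  shows "T (monomial \<beta> \<Lambda> n) = fscale (exp (- (of_real (\<Lambda> n) * b))) (monomial \<beta> \<Lambda> (Suc n))"
proof
  fix z
  show "T (monomial \<beta> \<Lambda> n) z
      = fscale (exp (- (of_real (\<Lambda> n) * b))) (monomial \<beta> \<Lambda> (Suc n)) z"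
    using T_monomial[of z n] frequency_step[OF assms]
    by (cases "z \<in> H_domain \<beta> \<Lambda>") (auto simp: fscale_def monomial_def comp_op_def)
qed

text \<open>
  By truncated subtraction the coefficients \<open>0\<close> and \<open>1\<close> of the image are both multiples of
  \<open>c 0 = 0\<close>; the vanishing of the latter is what obstructs supercyclicity.
\<close>

lemma T_shifts_coeffs:
  assumes f: "has_coeffs \<beta> \<Lambda> f c"
  shows "has_coeffs \<beta> \<Lambda> (T f) (\<lambda>n. c (n - 1) * exp (- (of_real (\<Lambda> (n - 1)) * b)))"
proof (rule has_coeffs_if_sums)
  show "T f \<in> H_space \<beta> \<Lambda>" using f by (intro T_in_H_space) (auto simp: H_space_def)
  have c0: "c 0 = 0" using f by (simp add: has_coeffs_def)
  then show "c (0 - 1) * exp (- (of_real (\<Lambda> (0 - 1)) * b)) = 0" by simp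
  fix z assume z: "z \<in> H_domain \<beta> \<Lambda>"
  let ?t = "\<lambda>n. c n * exp (- (of_real (\<Lambda> n) * b)) * exp (- (of_real (\<Lambda> (Suc n)) * z))"
  have "?t (Suc n) = c (Suc n) * exp (- (of_real (\<Lambda> (Suc n)) * (of_real a * z + b)))" for n
  proof -
    have "complex_of_real (\<Lambda> (Suc (Suc n))) = of_real a * of_real (\<Lambda> (Suc n))"
      using frequency_step[of "Suc n"] by (metis le_add1 of_real_mult plus_1_eq_Suc)
    then show ?thesis by (simp add: exp_add[symmetric] algebra_simps)
  qed
  moreover have "(\<lambda>n. c (Suc n) * exp (- (of_real (\<Lambda> (Suc n)) * (of_real a * z + b))))
      sums f (of_real a * z + b)"
    using f symbol_in_H_domain[OF z] by (simp add: has_coeffs_def)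
  ultimately have "(\<lambda>n. ?t (Suc n)) sums f (of_real a * z + b)" by (simp only:)
  then have "?t sums (f (of_real a * z + b) + ?t 0)" by (rule sums_Suc[where f = ?t])
  then show "(\<lambda>n. c (Suc n - 1) * exp (- (of_real (\<Lambda> (Suc n - 1)) * b))
      * exp (- (of_real (\<Lambda> (Suc n)) * z))) sums T f z"
    using z c0 by (simp add: comp_op_def)
qed

section \<open>Cyclicity\<close>

lemma T_linear: "T (fscale \<mu> f) = fscale \<mu> (T f)"
  by (auto simp: comp_op_def fscale_def)

lemma funpow_T_monomial: "\<exists>\<mu>. \<mu> \<noteq> 0 \<and> (T ^^ n) (monomial \<beta> \<Lambda> 1) = fscale \<mu> (monomial \<beta> \<Lambda> (Suc n))"
proof (induction n)
  case 0
  show ?case by (rule exI[of _ 1]) (simp add: fscale_def)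
next
  case (Suc n)
  then obtain \<mu> where \<mu>: "\<mu> \<noteq> 0" "(T ^^ n) (monomial \<beta> \<Lambda> 1) = fscale \<mu> (monomial \<beta> \<Lambda> (Suc n))"
    by blast
  have "(T ^^ Suc n) (monomial \<beta> \<Lambda> 1)
      = fscale (\<mu> * exp (- (of_real (\<Lambda> (Suc n)) * b))) (monomial \<beta> \<Lambda> (Suc (Suc n)))"
    by (simp add: \<mu>(2)[simplified] T_linear T_shifts_monomial)
  with \<mu>(1) show ?case by (metis exp_not_eq_zero mult_eq_0_iff)
qed

lemma monomial_in_span_Orb: "monomial \<beta> \<Lambda> (Suc n) \<in> fun_space.span (Orb T (monomial \<beta> \<Lambda> 1))"
proof -
  obtain \<mu> where \<mu>: "\<mu> \<noteq> 0" "(T ^^ n) (monomial \<beta> \<Lambda> 1) = fscale \<mu> (monomial \<beta> \<Lambda> (Suc n))"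
    using funpow_T_monomial by blast
  have "(T ^^ n) (monomial \<beta> \<Lambda> 1) \<in> fun_space.span (Orb T (monomial \<beta> \<Lambda> 1))"
    by (rule fun_space.span_base) (auto simp: Orb_def)
  from fun_space.span_scale[OF this, of "inverse \<mu>"] \<mu> show ?thesis by simp
qed

lemma T_cyclic: "cyclic_operator (H_topology \<beta> \<Lambda>) T"
  unfolding cyclic_operator_def
proof (rule bexI[of _ "monomial \<beta> \<Lambda> 1"], unfold closure_H_eq_topspace, intro ballI allI impI)
  let ?span = "fun_space.span (Orb T (monomial \<beta> \<Lambda> 1))"
  show "monomial \<beta> \<Lambda> 1 \<in> topspace (H_topology \<beta> \<Lambda>)"
    using monomial_has_coeffs[of 1] by (auto simp: topspace_H H_space_def)
  fix f \<epsilon> assume "f \<in> H_space \<beta> \<Lambda>" "0 < (\<epsilon> :: real)"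
  then obtain c where c: "has_coeffs \<beta> \<Lambda> f c" by (auto simp: H_space_def)
  obtain N where N: "H_dist \<beta> \<Lambda> f (\<Sum>k\<in>{1..N}. fscale (c k) (monomial \<beta> \<Lambda> k)) < \<epsilon>"
    using partial_sums_dense[OF c \<open>0 < \<epsilon>\<close>] by blast
  let ?g = "\<Sum>k\<in>{1..N}. fscale (c k) (monomial \<beta> \<Lambda> k)"
  have "monomial \<beta> \<Lambda> k \<in> ?span" if "k \<in> {1..N}" for k
    using monomial_in_span_Orb[of "k - 1"] that by simp
  then have "?g \<in> ?span" by (intro fun_space.span_sum fun_space.span_scale)
  moreover have "?g \<in> H_space \<beta> \<Lambda>"
    using has_coeffs_sum_monomials[of "{1..N}" \<beta> \<Lambda> c] by (auto simp: H_space_def)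
  ultimately show "\<exists>g\<in>?span. g \<in> H_space \<beta> \<Lambda> \<and> H_dist \<beta> \<Lambda> f g < \<epsilon>" using N by blast
qed

section \<open>Failure of supercyclicity\<close>

lemma funpow_T_first_coeff:
  assumes "x \<in> H_space \<beta> \<Lambda>" "has_coeffs \<beta> \<Lambda> ((T ^^ Suc n) x) d"
  shows "d 1 = 0"
proof -
  have "(T ^^ n) x \<in> H_space \<beta> \<Lambda>" by (induction n) (auto intro: assms(1) T_in_H_space)
  then obtain c where c: "has_coeffs \<beta> \<Lambda> ((T ^^ n) x) c" by (auto simp: H_space_def)
  have "has_coeffs \<beta> \<Lambda> ((T ^^ Suc n) x) (\<lambda>n. c (n - 1) * exp (- (of_real (\<Lambda> (n - 1)) * b)))"
    using T_shifts_coeffs[OF c] by simp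
  from has_coeffs_unique[OF mono lim L assms(2) this] c show ?thesis by (simp add: has_coeffs_def)
qed

text \<open>
  A dense projective orbit comes close to the function with coefficients \<open>1, v, 0, 0, \<dots>\<close>.  The
  approximating multiple of an iterate has a nonzero first coefficient because \<open>1 / 4 < 1\<close>, so the
  iterate is \<open>x\<close> itself.  The tolerance \<open>1 / 4\<close> is also small enough to make the conclusions for
  \<open>v = 0\<close> and \<open>v = 1\<close> contradict each other.
\<close>

lemma multiples_approximate_first_two_coeffs:
  assumes x: "has_coeffs \<beta> \<Lambda> x c"
    and dense: "H_topology \<beta> \<Lambda> closure_of {fscale \<mu> y | \<mu> y. y \<in> Orb T x} = topspace (H_topology \<beta> \<Lambda>)"
  shows "\<exists>\<mu>. cmod (1 - \<mu> * c 1) < 1 / 4 \<and> cmod (v - \<mu> * c 2) < 1 / 4"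
proof -
  let ?u = "\<lambda>k. if k = 1 then 1 else v"
  define f where "f = (\<Sum>k\<in>{1, 2}. fscale (?u k) (monomial \<beta> \<Lambda> k))"
  have f: "has_coeffs \<beta> \<Lambda> f (\<lambda>k. if k \<in> {1, 2} then ?u k else 0)"
    unfolding f_def by (rule has_coeffs_sum_monomials) auto
  define \<epsilon> where "\<epsilon> = min (\<beta> 1) (\<beta> 2) / 4"
  have \<epsilon>: "\<epsilon> > 0" using pos[of 1] pos[of 2] by (simp add: \<epsilon>_def)
  have xH: "x \<in> H_space \<beta> \<Lambda>" and "f \<in> H_space \<beta> \<Lambda>" using x f by (auto simp: H_space_def)
  with dense \<epsilon> obtain \<mu> y where y: "y \<in> Orb T x" "fscale \<mu> y \<in> H_space \<beta> \<Lambda>"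
    and close: "H_dist \<beta> \<Lambda> f (fscale \<mu> y) < \<epsilon>"
    unfolding closure_H_eq_topspace by blast
  obtain n where n: "y = (T ^^ n) x" using y by (auto simp: Orb_def)
  have "y \<in> H_space \<beta> \<Lambda>" unfolding n by (induction n) (auto intro: xH T_in_H_space)
  then obtain d where d: "has_coeffs \<beta> \<Lambda> y d" by (auto simp: H_space_def)
  have near: "cmod ((if Suc k \<in> {1, 2} then ?u (Suc k) else 0) - \<mu> * d (Suc k)) * \<beta> (Suc k) < \<epsilon>" for k
    using coeff_diff_le_dist[OF f has_coeffs_fscale[OF d, of \<mu>], of k] close by linarith
  have first: "cmod (1 - \<mu> * d 1) < 1 / 4"
  proof -
    have "cmod (1 - \<mu> * d 1) * \<beta> 1 < 1 / 4 * \<beta> 1" using near[of 0] by (simp add: \<epsilon>_def)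
    then show ?thesis using pos[of 1] by (simp only: mult_less_cancel_right_pos)
  qed
  have second: "cmod (v - \<mu> * d 2) < 1 / 4"
  proof -
    have "cmod (v - \<mu> * d 2) * \<beta> 2 < 1 / 4 * \<beta> 2"
      using near[of 1] by (simp add: \<epsilon>_def numeral_2_eq_2)
    then show ?thesis using pos[of 2] by (simp only: mult_less_cancel_right_pos)
  qed
  have "n = 0"
  proof (rule ccontr)
    assume "n \<noteq> 0"
    then have "d 1 = 0" using funpow_T_first_coeff[OF xH, of "n - 1" d] d n by simp
    with first show False by simp
  qed
  then have "d = c" using d n has_coeffs_unique[OF mono lim L _ x] by auto
  with first second show ?thesis by blast
qed

lemma T_not_supercyclic: "\<not> supercyclic_operator (H_topology \<beta> \<Lambda>) T"
proof
  assume "supercyclic_operator (H_topology \<beta> \<Lambda>) T"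
  then obtain x where x: "x \<in> H_space \<beta> \<Lambda>"
    and dense: "H_topology \<beta> \<Lambda> closure_of {fscale \<mu> y | \<mu> y. y \<in> Orb T x} = topspace (H_topology \<beta> \<Lambda>)"
    by (auto simp: supercyclic_operator_def topspace_H)
  obtain c where c: "has_coeffs \<beta> \<Lambda> x c" using x by (auto simp: H_space_def)
  note approx = multiples_approximate_first_two_coeffs[OF c dense]
  obtain \<mu> where \<mu>: "cmod (1 - \<mu> * c 1) < 1 / 4" "cmod (0 - \<mu> * c 2) < 1 / 4"
    using approx[of 0] by blast
  obtain \<nu> where \<nu>: "cmod (1 - \<nu> * c 1) < 1 / 4" "cmod (1 - \<nu> * c 2) < 1 / 4"
    using approx[of 1] by blast
  have lower: "cmod w > 3 / 4" if "cmod (1 - w) < 1 / 4" for w :: complex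
    using norm_triangle_ineq[of "1 - w" w] that by simp
  have upper: "cmod w < 5 / 4" if "cmod (1 - w) < 1 / 4" for w :: complex
    using norm_triangle_ineq4[of 1 "1 - w"] that by simp
  \<comment> \<open>The two multiples of \<open>x\<close> have the same ratio of coefficients; this is its cross-multiplied form.\<close>
  have "cmod (\<mu> * c 1) * cmod (\<nu> * c 2) = cmod (\<mu> * c 2) * cmod (\<nu> * c 1)"
    by (simp add: norm_mult)
  moreover have "3 / 4 * (3 / 4) < cmod (\<mu> * c 1) * cmod (\<nu> * c 2)"
    using lower[OF \<mu>(1)] lower[OF \<nu>(2)] by (intro mult_strict_mono) auto
  moreover have "cmod (\<mu> * c 2) * cmod (\<nu> * c 1) \<le> 1 / 4 * (5 / 4)"
    using \<mu>(2) upper[OF \<nu>(1)] by (intro mult_mono) auto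
  ultimately show False by simp
qed

end

section \<open>Cyclic but not supercyclic\<close>

theorem proposition5p6:
  fixes \<Lambda> \<beta> :: "nat \<Rightarrow> real" and a :: real and b :: complex
  assumes "strict_mono_on {1..} \<Lambda>"
    and "\<And>n. n \<ge> 1 \<Longrightarrow> \<Lambda> n \<ge> 0"
    and "filterlim \<Lambda> at_top sequentially"
    and "Llimsup \<Lambda> < \<infinity>"
    and "\<And>n. n \<ge> 1 \<Longrightarrow> \<beta> n > 0"
    and "beta_star \<beta> \<Lambda> \<noteq> \<infinity>" and "beta_star \<beta> \<Lambda> \<noteq> -\<infinity>"
    and "a > 1"
    and "bounded_comp_op \<beta> \<Lambda> (\<lambda>z. of_real a * z + b)"
    and "\<exists>!k. initial_point \<Lambda> a k"
  shows "cyclic_operator (H_topology \<beta> \<Lambda>) (comp_op \<beta> \<Lambda> (\<lambda>z. of_real a * z + b))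
       \<and> \<not> supercyclic_operator (H_topology \<beta> \<Lambda>) (comp_op \<beta> \<Lambda> (\<lambda>z. of_real a * z + b))"
proof -
  interpret one_initial_point \<Lambda> \<beta> a b
    by unfold_locales (fact assms)+
  show ?thesis using T_cyclic T_not_supercyclic by blast
qed

end
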